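(* Let $n>1$ be an integer and let $x,y\in\mathbb{R}^n$. Suppose that there exists a finite set $S_{xy}\subseteq\mathbb{R}^n$ containing $x$ and $y$ such that every map $f:S_{xy}\to\mathbb{R}^n$ preserving all unit distances satisfies $|f(x)-f(y)|=|x-y|$. Then $|x-y|$ is an algebraic number.
   Context: $|\cdot|$ is the Euclidean norm on $\mathbb{R}^n$. A map $f:S\to\mathbb{R}^n$ with $S\subseteq\mathbb{R}^n$ preserves all unit distances if for all $u,v\in S$, $|u-v|=1$ implies $|f(u)-f(v)|=1$. Maps are arbitrary functions (no continuity or injectivity is assumed). *)

theory Defs
  imports "HOL-Analysis.Analysis" "HOL-Computational_Algebra.Polynomial"
begin

text \<open>
  A map with domain \<open>S\<close> is a total HOL function of which only the values on \<open>S\<close> are used.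
\<close>

definition preserves_unit_distances ::
    "(real ^ 'n) set \<Rightarrow> (real ^ 'n \<Rightarrow> real ^ 'n) \<Rightarrow> bool" where
  "preserves_unit_distances S f \<longleftrightarrow>
     (\<forall>u\<in>S. \<forall>v\<in>S. norm (u - v) = 1 \<longrightarrow> norm (f u - f v) = 1)"

end

theory Submission
  imports Defs
begin

text \<open>
  The ring \<open>A\<close> generated by the coordinates of the points of the rigid set \<open>S\<close> has homomorphisms
  into the real algebraic numbers that are arbitrarily close to the identity. They are built by
  adjoining one generator \<open>t\<close> at a time: a transcendental \<open>t\<close> is sent to a nearby rational, and an
  algebraic \<open>t\<close>, being a simple root of its minimal polynomial, to a nearby root of the image
  polynomial, which exists by a change of sign. Applying such a homomorphism \<open>\<phi>\<close> to the coordinates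
  is a map that preserves unit distances, since \<open>|u - v|\<^sup>2\<close> is an integer polynomial in the
  coordinates. By rigidity \<open>|x - y|\<^sup>2 = \<phi> (|x - y|\<^sup>2)\<close>, which is algebraic. Closeness to the identity
  is not needed at the end; it is what carries the induction, through the change of sign.
\<close>

section \<open>Finite-dimensional rings over the rationals\<close>

interpretation over_rat: vector_space "\<lambda>q (x :: 'a :: field_char_0). of_rat q * x"
  by unfold_locales (auto simp: algebra_simps of_rat_add of_rat_mult)

text \<open>Closure under differences packs 0, negatives and sums into one condition; they are
  recovered below.\<close>

definition subring :: "'a :: idom set \<Rightarrow> bool" where
  "subring A \<longleftrightarrow> 1 \<in> A \<and> (\<forall>a\<in>A. \<forall>b\<in>A. a - b \<in> A \<and> a * b \<in> A)"

definition polys_over :: "'a :: idom set \<Rightarrow> 'a poly set" where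
  "polys_over A = {p. \<forall>i. coeff p i \<in> A}"

text \<open>These are the number fields inside \<open>'a\<close>. Closure under inverses is not
  demanded: finite dimension over the rationals forces it, see
  \<open>finite_rat_ring_inverse\<close>.\<close>

definition finite_rat_ring :: "'a :: field_char_0 set \<Rightarrow> bool" where
  "finite_rat_ring K \<longleftrightarrow> subring K \<and> (\<exists>B. finite B \<and> K = over_rat.span B)"

lemma degree_pos_if_root:
  assumes "p \<noteq> 0" "poly p t = 0"
  shows "degree p > 0"
proof (rule ccontr)
  assume "\<not> degree p > 0"
  then obtain c where "p = [:c:]" using degree_eq_zeroE[of p] by auto
  then show False using assms by simp
qed

section \<open>Closure properties of subrings and of polynomials over them\<close>

context
  fixes A :: "'a :: idom set"
  assumes A: "subring A"
begin

lemma subring_1: "1 \<in> A"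
  and subring_diff: "a \<in> A \<Longrightarrow> b \<in> A \<Longrightarrow> a - b \<in> A"
  and subring_mult: "a \<in> A \<Longrightarrow> b \<in> A \<Longrightarrow> a * b \<in> A"
  using A by (auto simp: subring_def)

lemma subring_0: "0 \<in> A"
  using subring_diff[OF subring_1 subring_1] by simp

lemma subring_minus: "a \<in> A \<Longrightarrow> - a \<in> A"
  using subring_diff[OF subring_0] by simp

lemma subring_add: "a \<in> A \<Longrightarrow> b \<in> A \<Longrightarrow> a + b \<in> A"
  using subring_diff[of a "- b"] subring_minus by simp

lemma subring_sum: "(\<And>i. i \<in> I \<Longrightarrow> f i \<in> A) \<Longrightarrow> sum f I \<in> A"
  by (induction I rule: infinite_finite_induct) (auto intro: subring_0 subring_add)

lemma subring_of_nat: "of_nat n \<in> A"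
  by (induction n) (auto intro: subring_0 subring_add subring_1)

lemma polys_over_0: "0 \<in> polys_over A"
  and polys_over_1: "1 \<in> polys_over A"
  and polys_over_diff: "p \<in> polys_over A \<Longrightarrow> q \<in> polys_over A \<Longrightarrow> p - q \<in> polys_over A"
  and polys_over_mult: "p \<in> polys_over A \<Longrightarrow> q \<in> polys_over A \<Longrightarrow> p * q \<in> polys_over A"
  and polys_over_monom: "a \<in> A \<Longrightarrow> monom a n \<in> polys_over A"
  by (auto simp: polys_over_def coeff_mult
      intro: subring_0 subring_1 subring_diff subring_add subring_mult subring_sum)

lemma polys_over_pderiv: "p \<in> polys_over A \<Longrightarrow> pderiv p \<in> polys_over A"
  by (auto simp: polys_over_def coeff_pderiv simp del: of_nat_Suc intro!: subring_mult subring_of_nat)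

lemma polys_over_pCons_iff: "pCons a p \<in> polys_over A \<longleftrightarrow> a \<in> A \<and> p \<in> polys_over A"
  by (auto simp: polys_over_def coeff_pCons split: nat.splits)

lemma poly_in_subring: "p \<in> polys_over A \<Longrightarrow> x \<in> A \<Longrightarrow> poly p x \<in> A"
  by (induction p) (auto simp: polys_over_pCons_iff intro: subring_0 subring_add subring_mult)

text \<open>The set is A[t], written as the values at \<open>t\<close> of polynomials over
  \<open>A\<close>; each generator is adjoined in this form.\<close>

lemma subring_adjoin: "subring {poly p t |p. p \<in> polys_over A}"
  unfolding subring_def
proof (intro conjI ballI)
  have "poly 1 t \<in> {poly p t |p. p \<in> polys_over A}"
    using polys_over_1 by blast
  then show "1 \<in> {poly p t |p. p \<in> polys_over A}" by simp
next
  fix a b assume "a \<in> {poly p t |p. p \<in> polys_over A}" "b \<in> {poly p t |p. p \<in> polys_over A}"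
  then obtain p q where "p \<in> polys_over A" "q \<in> polys_over A" "a = poly p t" "b = poly q t"
    by blast
  then show "a - b \<in> {poly p t |p. p \<in> polys_over A}" "a * b \<in> {poly p t |p. p \<in> polys_over A}"
    by (auto intro: exI[of _ "p - q"] exI[of _ "p * q"] polys_over_diff polys_over_mult)
qed

end

text \<open>More powers than \<open>card B\<close> must be linearly dependent, and a dependency is a
  rational polynomial vanishing at \<open>x\<close>. Dependence concerns sets, so repeated powers
  are treated apart: then X^i - X^j does the job.\<close>

lemma powers_in_finite_span_imp_algebraic:
  fixes x :: "'a :: field_char_0"
  assumes "finite B" and powers: "\<And>i. x ^ i \<in> over_rat.span B"
  shows "algebraic x"
proof (cases "inj (\<lambda>i. x ^ i)")
  case True
  define S where "S = (\<lambda>i. x ^ i) ` {..card B}"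
  have inj: "inj_on (\<lambda>i. x ^ i) {..card B}"
    using True by (meson inj_on_subset subset_UNIV)
  have "card S = Suc (card B)" unfolding S_def
    by (simp add: card_image[OF inj])
  then have "over_rat.dependent S"
    using over_rat.independent_span_bound[OF \<open>finite B\<close>, of S] powers
    by (fastforce simp: S_def)
  then obtain u v where v: "v \<in> S" "u v \<noteq> 0" and sum: "(\<Sum>v\<in>S. of_rat (u v) * v) = 0"
    by (subst (asm) over_rat.dependent_finite) (auto simp: S_def)
  then obtain j where j: "j \<le> card B" "v = x ^ j"
    by (auto simp: S_def)
  define p where "p = (\<Sum>i\<le>card B. monom (of_rat (u (x ^ i))) i :: 'a poly)"
  have coeff: "coeff p i = (if i \<le> card B then of_rat (u (x ^ i)) else 0)" for i
    by (simp add: p_def coeff_sum coeff_monom)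
  show ?thesis
  proof (rule algebraicI')
    show "coeff p i \<in> \<rat>" for i by (simp add: coeff)
    show "p \<noteq> 0" using v j coeff[of j] by auto
    have "poly p x = (\<Sum>i\<le>card B. of_rat (u (x ^ i)) * x ^ i)"
      by (simp add: p_def poly_sum poly_monom)
    also have "\<dots> = (\<Sum>v\<in>S. of_rat (u v) * v)"
      unfolding S_def by (simp add: sum.reindex[OF inj])
    finally show "poly p x = 0" using sum by simp
  qed
next
  case False
  then obtain i j where ij: "i \<noteq> j" "x ^ i = x ^ j" by (auto simp: inj_def)
  show ?thesis
  proof (rule algebraicI')
    show "coeff (monom 1 i - monom 1 j) n \<in> \<rat>" for n by (simp add: coeff_monom)
    show "monom 1 i - monom 1 j \<noteq> (0 :: 'a poly)" using ij by (simp add: monom_eq_iff')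
    show "poly (monom 1 i - monom 1 j) x = 0" using ij by (simp add: poly_monom)
  qed
qed

section \<open>Number fields: algebraicity, inverses, adjoining a root\<close>

context
  fixes K :: "'a :: field_char_0 set"
  assumes K: "finite_rat_ring K"
begin

lemma finite_rat_ring_subring: "subring K"
  using K by (simp add: finite_rat_ring_def)

lemma finite_rat_ring_scale: "x \<in> K \<Longrightarrow> of_rat q * x \<in> K"
  using K by (auto simp: finite_rat_ring_def intro: over_rat.span_scale)

lemma finite_rat_ring_of_rat: "of_rat q \<in> K"
  using finite_rat_ring_scale[OF subring_1[OF finite_rat_ring_subring], of q] by simp

lemma finite_rat_ring_algebraic:
  assumes "x \<in> K"
  shows "algebraic x"
proof -
  obtain B where B: "finite B" "K = over_rat.span B"
    using K by (auto simp: finite_rat_ring_def)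
  have "x ^ i \<in> K" for i
    by (induction i) (auto intro: assms subring_1 subring_mult finite_rat_ring_subring)
  then show ?thesis
    using powers_in_finite_span_imp_algebraic B by blast
qed

text \<open>A rational polynomial c + X q(X) vanishing at \<open>x\<close> with c nonzero gives 1/x
  = -q(x)/c, which is again in \<open>K\<close>.\<close>

lemma finite_rat_ring_inverse:
  assumes "x \<in> K"
  shows "inverse x \<in> K"
proof (cases "x = 0")
  case False
  obtain p where "coeff p 0 \<noteq> 0" "poly (map_poly of_int p) x = 0"
    using algebraicE'_nonzero[OF finite_rat_ring_algebraic[OF assms] False] by blast
  then obtain p :: "'a poly" where p: "\<And>i. coeff p i \<in> \<rat>" "poly p x = 0" "coeff p 0 \<noteq> 0"
    by (intro that[of "map_poly of_int p"]) (auto simp: coeff_map_poly)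
  obtain c q where q: "p = pCons c q" by (cases p)
  have "q \<in> polys_over K"
    unfolding polys_over_def
  proof safe
    fix i show "coeff q i \<in> K"
      using p(1)[of "Suc i"] finite_rat_ring_of_rat by (auto simp: q elim: Rats_cases)
  qed
  then have *: "poly q x \<in> K"
    using assms by (rule poly_in_subring[OF finite_rat_ring_subring])
  obtain r where r: "c = of_rat r" using p(1)[of 0] by (auto simp: q elim: Rats_cases)
  have "c + x * poly q x = 0" and "c \<noteq> 0" using p by (auto simp: q)
  then have "inverse x = - inverse c * poly q x"
    using False by (simp add: field_simps add_eq_0_iff)
  also have "\<dots> = of_rat (- inverse r) * poly q x"
    by (simp add: r of_rat_minus of_rat_inverse)
  also have "\<dots> \<in> K" by (rule finite_rat_ring_scale[OF *])
  finally show ?thesis .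
qed (use assms in auto)

text \<open>With n the degree of \<open>g\<close>, the products of generators of \<open>K\<close>
  with t^j for j < n already span K[t]: the equation g(t) = 0 rewrites t^n through lower powers, as
  the leading coefficient of \<open>g\<close> is invertible in \<open>K\<close>. Irreducibility of
  \<open>g\<close> is not assumed.\<close>

lemma finite_rat_ring_adjoin_root:
  assumes g: "g \<in> polys_over K" "g \<noteq> 0" "poly g t = 0"
  shows "\<exists>K'. finite_rat_ring K' \<and> K \<subseteq> K' \<and> t \<in> K'"
proof -
  note ring = finite_rat_ring_subring
  obtain B where B: "finite B" "K = over_rat.span B"
    using K by (auto simp: finite_rat_ring_def)
  define n where "n = degree g"
  have n: "n > 0"
    using degree_pos_if_root[OF g(2,3)] by (simp add: n_def)
  define W where "W = over_rat.span ((\<lambda>(b, j). b * t ^ j) ` (B \<times> {..<n}))"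
  have sub: "over_rat.subspace W" by (simp add: W_def)
  \<comment> \<open>Preimages of \<open>W\<close> under multiplication by \<open>w\<close> are
    subspaces, so closure of \<open>W\<close> under such a multiplication can be tested on
    generators (\<open>W_least\<close>).\<close>
  have sub': "over_rat.subspace {v. v * w \<in> W}" for w
    using sub unfolding over_rat.subspace_def by (auto simp: distrib_right mult.assoc)
  have W_gen: "b * t ^ j \<in> W" if "b \<in> B" "j < n" for b j
    unfolding W_def by (rule over_rat.span_base) (use that in force)
  have W_least: "W \<subseteq> {v. v * w \<in> W}"
    if "\<And>b j. b \<in> B \<Longrightarrow> j < n \<Longrightarrow> b * t ^ j * w \<in> W" for w
  proof -
    have "(\<lambda>(b, j). b * t ^ j) ` (B \<times> {..<n}) \<subseteq> {v. v * w \<in> W}"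
      using that by auto
    from over_rat.span_minimal[OF this sub'] show ?thesis by (simp add: W_def)
  qed
  have B_K: "b \<in> K" if "b \<in> B" for b
    using that by (simp add: B(2) over_rat.span_base)
  have low: "c * t ^ j \<in> W" if "c \<in> K" "j < n" for c j
  proof -
    have "over_rat.span B \<subseteq> {v. v * t ^ j \<in> W}"
      using W_gen that(2) by (intro over_rat.span_minimal sub') auto
    then show ?thesis using that(1) B(2) by auto
  qed
  have top: "c * t ^ n \<in> W" if "c \<in> K" for c
  proof -
    define l where "l = coeff g n"
    have l: "l \<noteq> 0" "l \<in> K" using g by (auto simp: l_def n_def polys_over_def)
    have "0 = (\<Sum>i<n. coeff g i * t ^ i) + l * t ^ n"
      using g(3) by (simp add: poly_altdef l_def n_def lessThan_Suc_atMost[symmetric])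
    then have "t ^ n = - inverse l * (\<Sum>i<n. coeff g i * t ^ i)"
      using l by (simp add: field_simps add_eq_0_iff)
    then have "c * t ^ n = (\<Sum>i<n. (- c * inverse l * coeff g i) * t ^ i)"
      by (simp add: sum_distrib_left mult_ac sum_negf)
    also have "\<dots> \<in> W"
      using l g that
      by (intro over_rat.subspace_sum[OF sub] low)
         (auto simp: polys_over_def intro!: subring_mult[OF ring] subring_minus[OF ring] finite_rat_ring_inverse)
    finally show ?thesis .
  qed
  have times_t: "w * t \<in> W" if "w \<in> W" for w
  proof -
    have "b * t ^ Suc j \<in> W" if "b \<in> B" "j < n" for b j
      using low[of b "Suc j"] top[of b] B_K that by (cases "Suc j = n") auto
    then have "W \<subseteq> {v. v * t \<in> W}"
      by (intro W_least) (simp add: mult_ac)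
    then show ?thesis using that by auto
  qed
  have all: "c * t ^ j \<in> W" if "c \<in> K" for c j
  proof (induction j)
    case 0
    show ?case using low[OF that n] by simp
  next
    case (Suc j)
    show ?case using times_t[OF Suc] by (simp add: mult_ac)
  qed
  \<comment> \<open>Bilinearity: extend from generators first in the left factor, then in the right
    one.\<close>
  have mult: "v * w \<in> W" if "v \<in> W" "w \<in> W" for v w
  proof -
    have gen: "(b' * t ^ i) * (b * t ^ j) \<in> W" if "b \<in> B" "b' \<in> B" for b b' i j
      using all[OF subring_mult[OF ring B_K[OF that(2)] B_K[OF that(1)]], of "i + j"]
      by (simp add: power_add mult_ac)
    have "W \<subseteq> {v. v * (b * t ^ j) \<in> W}" if "b \<in> B" for b j
      using gen[OF that] by (rule W_least)
    then have "v * (b * t ^ j) \<in> W" if "b \<in> B" for b j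
      using that \<open>v \<in> W\<close> by blast
    then have "W \<subseteq> {w. w * v \<in> W}"
      by (intro W_least) (simp add: mult.commute)
    then show ?thesis using \<open>w \<in> W\<close> by (auto simp: mult.commute)
  qed
  have "1 \<in> W" "t \<in> W" "K \<subseteq> W"
    using all[OF subring_1[OF ring], of 0] all[OF subring_1[OF ring], of 1] all[of _ 0] by auto
  moreover have "\<exists>C. finite C \<and> W = over_rat.span C"
    unfolding W_def by (rule exI, rule conjI[OF _ refl]) (simp add: B(1))
  then have "finite_rat_ring W"
    unfolding finite_rat_ring_def subring_def
    using \<open>1 \<in> W\<close> mult over_rat.subspace_diff[OF sub] by blast
  ultimately show ?thesis by blast
qed

end

lemma finite_rat_ring_Rats: "finite_rat_ring (\<rat> :: 'a :: field_char_0 set)"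
  unfolding finite_rat_ring_def
proof (intro conjI exI)
  show "\<rat> = over_rat.span {1 :: 'a}"
    by (auto simp: over_rat.span_singleton Rats_def)
qed (auto simp: subring_def)


section \<open>Extending ring homomorphisms\<close>

definition ring_hom_on :: "'a :: idom set \<Rightarrow> ('a \<Rightarrow> 'b :: idom) \<Rightarrow> bool" where
  "ring_hom_on A \<phi> \<longleftrightarrow> \<phi> 1 = 1 \<and>
     (\<forall>a\<in>A. \<forall>b\<in>A. \<phi> (a - b) = \<phi> a - \<phi> b \<and> \<phi> (a * b) = \<phi> a * \<phi> b)"

section \<open>Homomorphisms acting on coefficients, and their extension to A[t]\<close>

context
  fixes A :: "'a :: idom set" and \<phi> :: "'a \<Rightarrow> 'b :: idom"
  assumes A: "subring A" and hom: "ring_hom_on A \<phi>"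
begin

lemma hom_1: "\<phi> 1 = 1"
  and hom_diff: "a \<in> A \<Longrightarrow> b \<in> A \<Longrightarrow> \<phi> (a - b) = \<phi> a - \<phi> b"
  and hom_mult: "a \<in> A \<Longrightarrow> b \<in> A \<Longrightarrow> \<phi> (a * b) = \<phi> a * \<phi> b"
  using hom by (auto simp: ring_hom_on_def)

lemma hom_0: "\<phi> 0 = 0"
  using hom_diff[OF subring_1[OF A] subring_1[OF A]] by simp

lemma hom_add: "a \<in> A \<Longrightarrow> b \<in> A \<Longrightarrow> \<phi> (a + b) = \<phi> a + \<phi> b"
  using hom_diff[of a "- b"] hom_diff[of 0 b] by (simp add: hom_0 A subring_0 subring_minus)

lemma hom_sum: "(\<And>i. i \<in> I \<Longrightarrow> f i \<in> A) \<Longrightarrow> \<phi> (sum f I) = (\<Sum>i\<in>I. \<phi> (f i))"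
  by (induction I rule: infinite_finite_induct) (auto simp: hom_0 hom_add A subring_sum)

lemma map_poly_hom_diff:
  "p \<in> polys_over A \<Longrightarrow> q \<in> polys_over A \<Longrightarrow>
     map_poly \<phi> (p - q) = map_poly \<phi> p - map_poly \<phi> q"
  by (intro poly_eqI) (auto simp: coeff_map_poly hom_0 polys_over_def hom_diff)

lemma map_poly_hom_mult:
  "p \<in> polys_over A \<Longrightarrow> q \<in> polys_over A \<Longrightarrow>
     map_poly \<phi> (p * q) = map_poly \<phi> p * map_poly \<phi> q"
  by (intro poly_eqI)
     (auto simp: coeff_map_poly hom_0 polys_over_def coeff_mult hom_sum hom_mult A subring_mult)

lemma map_poly_hom_1: "map_poly \<phi> 1 = 1"
  by (simp add: hom_1 hom_0)

text \<open>A[t] is A[X] modulo the polynomials vanishing at \<open>t\<close>. Applying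
  \<open>\<phi>\<close> to coefficients and evaluating at \<open>t'\<close> kills these by
  \<open>kernel\<close>, so the value does not depend on the representative that \<open>SOME\<close>
  picks.\<close>

lemma hom_adjoin:
  assumes kernel: "\<And>h. h \<in> polys_over A \<Longrightarrow> poly h t = 0 \<Longrightarrow> poly (map_poly \<phi> h) t' = 0"
  shows "\<exists>\<psi>. ring_hom_on {poly p t |p. p \<in> polys_over A} \<psi> \<and>
           (\<forall>p\<in>polys_over A. \<psi> (poly p t) = poly (map_poly \<phi> p) t')"
proof -
  define \<psi> where "\<psi> x = poly (map_poly \<phi> (SOME p. p \<in> polys_over A \<and> poly p t = x)) t'" for x
  have \<psi>: "\<psi> (poly p t) = poly (map_poly \<phi> p) t'" if p: "p \<in> polys_over A" for p
  proof -
    define q where "q = (SOME q. q \<in> polys_over A \<and> poly q t = poly p t)"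
    have q: "q \<in> polys_over A" "poly q t = poly p t"
      using someI[of "\<lambda>q. q \<in> polys_over A \<and> poly q t = poly p t" p] p by (auto simp: q_def)
    have "poly (map_poly \<phi> (q - p)) t' = 0"
      by (intro kernel polys_over_diff A) (use p q in auto)
    then show ?thesis
      by (simp add: map_poly_hom_diff p q \<psi>_def flip: q_def)
  qed
  have "ring_hom_on {poly p t |p. p \<in> polys_over A} \<psi>"
    unfolding ring_hom_on_def
  proof (intro conjI ballI)
    show "\<psi> 1 = 1" using \<psi>[OF polys_over_1[OF A]] by (simp add: map_poly_hom_1 del: map_poly_1)
  next
    fix a b assume "a \<in> {poly p t |p. p \<in> polys_over A}" "b \<in> {poly p t |p. p \<in> polys_over A}"
    then obtain p q where pq: "p \<in> polys_over A" "q \<in> polys_over A" "a = poly p t" "b = poly q t"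
      by blast
    show "\<psi> (a - b) = \<psi> a - \<psi> b"
      using \<psi>[OF polys_over_diff[OF A pq(1,2)]] \<psi>[OF pq(1)] \<psi>[OF pq(2)] pq
      by (simp add: map_poly_hom_diff)
    show "\<psi> (a * b) = \<psi> a * \<psi> b"
      using \<psi>[OF polys_over_mult[OF A pq(1,2)]] \<psi>[OF pq(1)] \<psi>[OF pq(2)] pq
      by (simp add: map_poly_hom_mult)
  qed
  with \<psi> show ?thesis by blast
qed

text \<open>
  Cross-multiplying the leading terms of \<open>h\<close> and \<open>P\<close> lowers the degree of \<open>h\<close> without leaving \<open>A\<close>;
  the factor \<open>\<phi> (lead_coeff P)\<close> that this costs is cancelled in the target.
\<close>

lemma kernel_minimal_polynomial:
  assumes P: "P \<in> polys_over A" "P \<noteq> 0" "poly P t = 0"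
    and minimal: "\<And>q. q \<in> polys_over A \<Longrightarrow> q \<noteq> 0 \<Longrightarrow> poly q t = 0 \<Longrightarrow> degree P \<le> degree q"
    and lead: "\<phi> (lead_coeff P) \<noteq> 0" and root: "poly (map_poly \<phi> P) t' = 0"
    and h: "h \<in> polys_over A" "poly h t = 0"
  shows "poly (map_poly \<phi> h) t' = 0"
  using h
proof (induction "degree h" arbitrary: h rule: less_induct)
  case less
  show ?case
  proof (cases "h = 0")
    case False
    define m where "m = degree h - degree P"
    have deg: "degree h = m + degree P"
      using minimal[OF less.prems(1) False less.prems(2)] by (simp add: m_def)
    have "degree P > 0" using P by (intro degree_pos_if_root)
    define u v where "u = [:lead_coeff P:]" and "v = monom (lead_coeff h) m"
    have lc: "lead_coeff P \<in> A" "lead_coeff h \<in> A"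
      using P less.prems by (auto simp: polys_over_def)
    have u: "u \<in> polys_over A" and v: "v \<in> polys_over A"
      using lc by (auto simp: u_def v_def polys_over_pCons_iff A polys_over_0 polys_over_monom)
    define h' where "h' = u * h - v * P"
    have h': "h' \<in> polys_over A" "poly h' t = 0"
      using u v P less.prems
      by (auto simp: h'_def A intro!: polys_over_diff polys_over_mult)
    have "coeff h' i = 0" if "i \<ge> degree h" for i
    proof (cases "i = degree h")
      case True
      then show ?thesis
        by (simp add: h'_def u_def v_def coeff_monom_mult deg)
    next
      case False
      then have "i > degree h" using that by simp
      then show ?thesis
        by (simp add: h'_def u_def v_def coeff_monom_mult deg coeff_eq_0)
    qed
    \<comment> \<open>Positive degree of \<open>h\<close> matters here: the zero polynomial also has
      degree 0, so vanishing top coefficients would not lower the degree of a constant.\<close>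
    then have "degree h' < degree h"
      using \<open>degree P > 0\<close> deg by (metis add_gr_0 coeff_0_degree_minus_1 degree_0 leading_coeff_0_iff not_less)
    then have "poly (map_poly \<phi> h') t' = 0"
      using less.hyps h' by blast
    moreover have "poly (map_poly \<phi> h') t' =
        \<phi> (lead_coeff P) * poly (map_poly \<phi> h) t' - poly (map_poly \<phi> v) t' * poly (map_poly \<phi> P) t'"
      using u v P less.prems
      by (simp add: h'_def map_poly_hom_diff map_poly_hom_mult polys_over_mult A)
         (simp add: u_def map_poly_pCons hom_0)
    ultimately show ?thesis using lead root by simp
  qed (simp add: hom_0)
qed

end

text \<open>Coefficients and evaluation point may move together. A constant \<open>s\<close> gives
  pointwise convergence of the image polynomials, used to find roots; a moving \<open>s\<close>
  gives convergence of the extended homomorphisms.\<close>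

lemma tendsto_poly_map_poly:
  fixes \<phi> :: "nat \<Rightarrow> real \<Rightarrow> real"
  assumes "subring A" "\<And>k. ring_hom_on A (\<phi> k)"
    and "\<And>a. a \<in> A \<Longrightarrow> (\<lambda>k. \<phi> k a) \<longlonglongrightarrow> a" and "s \<longlonglongrightarrow> t" and "p \<in> polys_over A"
  shows "(\<lambda>k. poly (map_poly (\<phi> k) p) (s k)) \<longlonglongrightarrow> poly p t"
  using assms(5)
proof (induction p)
  case (pCons a p)
  have "map_poly (\<phi> k) (pCons a p) = pCons (\<phi> k a) (map_poly (\<phi> k) p)" for k
    using hom_0[OF assms(1,2)]
    by (intro poly_eqI) (auto simp: coeff_map_poly coeff_pCons split: nat.splits)
  with pCons assms show ?case
    by (auto simp: polys_over_pCons_iff intro!: tendsto_intros)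
qed simp


section \<open>Approximating the reals by algebraic numbers\<close>

text \<open>At a simple root \<open>P\<close> changes sign between two nearby points. Convergence at
  just these two points carries the sign change over to \<open>Q k\<close>, and the intermediate
  value theorem yields the root.\<close>

lemma eventually_root_near_simple_root:
  fixes t :: real
  assumes root: "poly P t = 0" and simple: "poly (pderiv P) t \<noteq> 0" and "\<epsilon> > 0"
    and lim: "\<And>x. (\<lambda>k. poly (Q k) x) \<longlonglongrightarrow> poly P x"
  shows "\<forall>\<^sub>F k in sequentially. \<exists>r. \<bar>r - t\<bar> < \<epsilon> \<and> poly (Q k) r = 0"
proof -
  have "\<exists>a b. t - \<epsilon> < a \<and> a < b \<and> b < t + \<epsilon> \<and> poly P a * poly P b < 0"
  proof -
    have der: "DERIV (poly P) t :> poly (pderiv P) t" by (rule poly_DERIV)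
    have "\<exists>d>0. \<forall>h>0. h < d \<longrightarrow> poly P (t - h) * poly P (t + h) < 0"
    proof (cases "poly (pderiv P) t > 0")
      case True
      obtain d1 d2 where d: "d1 > 0" "\<And>h. h > 0 \<Longrightarrow> h < d1 \<Longrightarrow> poly P t < poly P (t + h)"
        "d2 > 0" "\<And>h. h > 0 \<Longrightarrow> h < d2 \<Longrightarrow> poly P (t - h) < poly P t"
        using DERIV_pos_inc_right[OF der True] DERIV_pos_inc_left[OF der True] by blast
      then show ?thesis using root
        by (intro exI[of _ "min d1 d2"]) (auto simp: mult_neg_pos)
    next
      case False
      then have neg: "poly (pderiv P) t < 0" using simple by simp
      obtain d1 d2 where d: "d1 > 0" "\<And>h. h > 0 \<Longrightarrow> h < d1 \<Longrightarrow> poly P (t + h) < poly P t"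
        "d2 > 0" "\<And>h. h > 0 \<Longrightarrow> h < d2 \<Longrightarrow> poly P t < poly P (t - h)"
        using DERIV_neg_dec_right[OF der neg] DERIV_neg_dec_left[OF der neg] by blast
      then show ?thesis using root
        by (intro exI[of _ "min d1 d2"]) (auto simp: mult_pos_neg)
    qed
    then obtain d where d: "d > 0" "\<And>h. h > 0 \<Longrightarrow> h < d \<Longrightarrow> poly P (t - h) * poly P (t + h) < 0"
      by blast
    define h where "h = min d \<epsilon> / 2"
    have "h > 0" "h < d" "h < \<epsilon>" using d(1) \<open>\<epsilon> > 0\<close> by (auto simp: h_def)
    then show ?thesis using d(2)[of h] by (intro exI[of _ "t - h"] exI[of _ "t + h"]) auto
  qed
  then obtain a b where ab: "t - \<epsilon> < a" "a < b" "b < t + \<epsilon>" "poly P a * poly P b < 0" by blast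
  have "(\<lambda>k. poly (Q k) a * poly (Q k) b) \<longlonglongrightarrow> poly P a * poly P b"
    by (intro tendsto_mult lim)
  then have "\<forall>\<^sub>F k in sequentially. poly (Q k) a * poly (Q k) b < 0"
    using ab(4) by (rule order_tendstoD)
  then show ?thesis
  proof eventually_elim
    case (elim k)
    then obtain r where "a < r" "r < b" "poly (Q k) r = 0"
      using poly_IVT[OF ab(2)] by blast
    then show ?case using ab by (intro exI[of _ r]) auto
  qed
qed

text \<open>
  The images lie in finite-dimensional rings \<open>K k\<close>, and not just in the algebraic numbers, so that
  adjoining a root of a polynomial over \<open>K k\<close> stays algebraic without a general closure theorem.
\<close>

definition approximable :: "real set \<Rightarrow> bool" where
  "approximable A \<longleftrightarrow> (\<exists>\<phi> K.
     (\<forall>k :: nat. ring_hom_on A (\<phi> k) \<and> finite_rat_ring (K k :: real set) \<and> \<phi> k ` A \<subseteq> K k) \<and>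
     (\<forall>a\<in>A. (\<lambda>k. \<phi> k a) \<longlonglongrightarrow> a))"

text \<open>The image of \<open>t\<close> must lie near \<open>t\<close> and satisfy the images of
  all relations of \<open>t\<close> over \<open>A\<close>. Such an image may exist only for large
  indices, so the family is reindexed while it is extended.\<close>

lemma approximable_adjoin:
  assumes A: "subring A" and "approximable A"
  shows "approximable {poly p t |p. p \<in> polys_over A}"
proof -
  obtain \<phi> K where hom: "\<And>k :: nat. ring_hom_on A (\<phi> k)"
    and K: "\<And>k. finite_rat_ring (K k)" and \<phi>_K: "\<And>k a. a \<in> A \<Longrightarrow> \<phi> k a \<in> K k"
    and lim: "\<And>a. a \<in> A \<Longrightarrow> (\<lambda>k. \<phi> k a) \<longlonglongrightarrow> a"
    using assms(2) unfolding approximable_def image_subset_iff by blast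
  have map_K: "map_poly (\<phi> k) p \<in> polys_over (K k)" if "p \<in> polys_over A" for k p
    using that \<phi>_K by (auto simp: polys_over_def coeff_map_poly hom_0[OF A hom])
  \<comment> \<open>For precision 1/(n+1), \<open>k\<close> is the homomorphism to extend,
    \<open>r\<close> the image of \<open>t\<close>, and \<open>L\<close> a number field holding the
    extended image. The bound k \<ge> n preserves the limits.\<close>
  define good where "good n k r L \<longleftrightarrow>
      k \<ge> n \<and> \<bar>r - t\<bar> < 1 / Suc n \<and> finite_rat_ring L \<and> K k \<subseteq> L \<and> r \<in> L \<and>
      (\<forall>h\<in>polys_over A. poly h t = 0 \<longrightarrow> poly (map_poly (\<phi> k) h) r = 0)" for n k r L
  have "\<exists>k r L. good n k r L" for n
  proof (cases "\<exists>P\<in>polys_over A. P \<noteq> 0 \<and> poly P t = 0")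
    case False
    \<comment> \<open>No nonzero relation constrains the image of a transcendental \<open>t\<close>;
      a rational choice already lies in \<open>K n\<close>.\<close>
    obtain r where r: "r \<in> \<rat>" "t < r" "r < t + 1 / Suc n"
      using Rats_dense_in_real[of t "t + 1 / Suc n"] by auto
    have "r \<in> K n" using r(1) finite_rat_ring_of_rat[OF K] by (auto elim: Rats_cases)
    moreover have "\<bar>r - t\<bar> < 1 / Suc n" using r by linarith
    ultimately show ?thesis unfolding good_def using K False by (intro exI[of _ n] exI[of _ r] exI[of _ "K n"]) auto
  next
    case True
    then obtain P where P: "P \<in> polys_over A" "P \<noteq> 0" "poly P t = 0"
      and minimal: "\<And>q. q \<in> polys_over A \<Longrightarrow> q \<noteq> 0 \<Longrightarrow> poly q t = 0 \<Longrightarrow> degree P \<le> degree q"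
      using ex_has_least_nat[of "\<lambda>P. P \<in> polys_over A \<and> P \<noteq> 0 \<and> poly P t = 0" _ degree] by blast
    have "degree P > 0" using P by (intro degree_pos_if_root)
    then have "pderiv P \<noteq> 0" "degree (pderiv P) < degree P"
      by (auto simp: pderiv_eq_0_iff degree_pderiv)
    \<comment> \<open>The derivative is a nonzero polynomial over \<open>A\<close> of smaller
      degree, so by minimality it cannot vanish at \<open>t\<close>.\<close>
    then have simple: "poly (pderiv P) t \<noteq> 0"
      using minimal[OF polys_over_pderiv[OF A P(1)]] by linarith
    have "\<forall>\<^sub>F k in sequentially. \<exists>r. \<bar>r - t\<bar> < 1 / Suc n \<and> poly (map_poly (\<phi> k) P) r = 0"
      by (rule eventually_root_near_simple_root[OF P(3) simple])
         (auto intro: tendsto_poly_map_poly[OF A hom lim] P)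
    \<comment> \<open>\<open>P\<close> need not be monic, since \<open>A\<close> is only a ring. Its
      leading coefficient is the nonzero limit of its images, so these are nonzero from some index
      on.\<close>
    moreover have lc: "lead_coeff P \<in> A" using P by (auto simp: polys_over_def)
    then have "\<forall>\<^sub>F k in sequentially. \<phi> k (lead_coeff P) \<noteq> 0"
      using P(2) tendsto_imp_eventually_ne[OF lim] by simp
    ultimately have "\<forall>\<^sub>F k in sequentially. k \<ge> n \<and> \<phi> k (lead_coeff P) \<noteq> 0 \<and>
        (\<exists>r. \<bar>r - t\<bar> < 1 / Suc n \<and> poly (map_poly (\<phi> k) P) r = 0)"
      using eventually_ge_at_top[of n] by eventually_elim auto
    then obtain k r where k: "k \<ge> n" "\<phi> k (lead_coeff P) \<noteq> 0"
      and r: "\<bar>r - t\<bar> < 1 / Suc n" "poly (map_poly (\<phi> k) P) r = 0"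
      using eventually_happens'[OF sequentially_bot] by blast
    \<comment> \<open>The surviving leading coefficient keeps the image of \<open>P\<close> nonzero,
      as adjoining its root to \<open>K k\<close> requires.\<close>
    have "coeff (map_poly (\<phi> k) P) (degree P) \<noteq> 0"
      using k by (simp add: coeff_map_poly hom_0[OF A hom])
    then have "map_poly (\<phi> k) P \<noteq> 0" by (metis coeff_0)
    from finite_rat_ring_adjoin_root[OF K map_K[OF P(1)] this r(2)]
    obtain L where "finite_rat_ring L" "K k \<subseteq> L" "r \<in> L" by blast
    moreover have "poly (map_poly (\<phi> k) h) r = 0" if "h \<in> polys_over A" "poly h t = 0" for h
      by (rule kernel_minimal_polynomial[OF A hom P minimal k(2) r(2) that])
    ultimately show ?thesis unfolding good_def using k r by blast
  qed
  then obtain \<sigma> s L where good: "\<And>n. good n (\<sigma> n) (s n) (L n)" by metis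
  then have \<sigma>: "\<And>n. \<sigma> n \<ge> n" and s: "\<And>n. \<bar>s n - t\<bar> < 1 / Suc n"
    and L: "\<And>n. finite_rat_ring (L n)" "\<And>n. K (\<sigma> n) \<subseteq> L n" "\<And>n. s n \<in> L n"
    and kernel: "\<And>n h. h \<in> polys_over A \<Longrightarrow> poly h t = 0 \<Longrightarrow> poly (map_poly (\<phi> (\<sigma> n)) h) (s n) = 0"
    unfolding good_def by blast+
  have "\<exists>\<psi>. \<forall>n. ring_hom_on {poly p t |p. p \<in> polys_over A} (\<psi> n) \<and>
      (\<forall>p\<in>polys_over A. \<psi> n (poly p t) = poly (map_poly (\<phi> (\<sigma> n)) p) (s n))"
    by (intro choice allI hom_adjoin[OF A hom kernel])
  then obtain \<psi> where \<psi>: "\<And>n. ring_hom_on {poly p t |p. p \<in> polys_over A} (\<psi> n)"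
    "\<And>n p. p \<in> polys_over A \<Longrightarrow> \<psi> n (poly p t) = poly (map_poly (\<phi> (\<sigma> n)) p) (s n)"
    by blast
  have s_lim: "s \<longlonglongrightarrow> t"
  proof (rule LIM_zero_cancel, rule Lim_null_comparison)
    show "(\<lambda>n. 1 / real (Suc n)) \<longlonglongrightarrow> 0" by (rule LIMSEQ_Suc[OF lim_1_over_n])
    show "\<forall>\<^sub>F n in sequentially. norm (s n - t) \<le> 1 / real (Suc n)"
      using s by (intro always_eventually) (simp add: less_imp_le del: of_nat_Suc)
  qed
  \<comment> \<open>\<open>\<sigma>\<close> need not be monotone; \<sigma> n \<ge> n is enough to
    compose limits.\<close>
  have \<sigma>_lim: "filterlim \<sigma> at_top sequentially"
    by (rule filterlim_at_top_mono[OF filterlim_ident]) (auto simp: \<sigma>)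
  have lim': "(\<lambda>n. \<phi> (\<sigma> n) a) \<longlonglongrightarrow> a" if "a \<in> A" for a
    by (rule filterlim_compose[OF lim[OF that] \<sigma>_lim])
  show ?thesis
    unfolding approximable_def
  proof (intro exI[of _ \<psi>] exI[of _ L] conjI allI ballI)
    fix n
    have "map_poly (\<phi> (\<sigma> n)) p \<in> polys_over (L n)" if "p \<in> polys_over A" for p
      using map_K[OF that, of "\<sigma> n"] L(2)[of n] by (auto simp: polys_over_def)
    then show "\<psi> n ` {poly p t |p. p \<in> polys_over A} \<subseteq> L n"
      using L(3) by (auto simp: \<psi>(2) intro!: poly_in_subring[OF finite_rat_ring_subring[OF L(1)]])
  next
    fix a assume "a \<in> {poly p t |p. p \<in> polys_over A}"
    then obtain p where p: "p \<in> polys_over A" "a = poly p t" by blast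
    show "(\<lambda>n. \<psi> n a) \<longlonglongrightarrow> a"
      unfolding p(2) \<psi>(2)[OF p(1)]
      by (rule tendsto_poly_map_poly[OF A hom lim' s_lim p(1)])
  qed (use \<psi>(1) L(1) in auto)
qed

section \<open>Induction on the number of generators, starting from the integers\<close>

lemma approximable_Ints: "approximable \<int>"
  unfolding approximable_def
  by (rule exI[of _ "\<lambda>_ x. x"], rule exI[of _ "\<lambda>_. \<rat>"])
     (auto simp: ring_hom_on_def finite_rat_ring_Rats Ints_subset_Rats[THEN subsetD])

lemma subring_Ints: "subring \<int>"
  by (simp add: subring_def)

lemma ex_approximable_subring:
  assumes "finite X"
  shows "\<exists>A. subring A \<and> approximable A \<and> X \<subseteq> A"
  using assms
proof (induction X)
  case empty
  show ?case using subring_Ints approximable_Ints by blast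
next
  case (insert t X)
  then obtain A where A: "subring A" "approximable A" "X \<subseteq> A" by blast
  define A' where "A' = {poly p t |p. p \<in> polys_over A}"
  have "a \<in> A'" if "a \<in> A" for a
    using that unfolding A'_def
    by (intro CollectI exI[of _ "[:a:]"]) (simp add: polys_over_pCons_iff polys_over_0 A)
  moreover have "t \<in> A'"
    unfolding A'_def
    by (intro CollectI exI[of _ "[:0, 1:]"])
       (simp add: polys_over_pCons_iff polys_over_0 subring_0 subring_1 A)
  ultimately show ?case
    using A subring_adjoin[OF A(1)] approximable_adjoin[OF A(1,2)]
    by (intro exI[of _ A']) (auto simp: A'_def)
qed

lemma ex_algebraic_specialization:
  fixes X :: "real set"
  assumes "finite X"
  shows "\<exists>A \<phi>. subring A \<and> X \<subseteq> A \<and> ring_hom_on A \<phi> \<and> (\<forall>a\<in>A. algebraic (\<phi> a :: real))"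
proof -
  obtain A where A: "subring A" "approximable A" "X \<subseteq> A"
    using ex_approximable_subring[OF assms] by blast
  then obtain \<phi> :: "nat \<Rightarrow> real \<Rightarrow> real" and K where
    "\<And>k. ring_hom_on A (\<phi> k) \<and> finite_rat_ring (K k) \<and> \<phi> k ` A \<subseteq> K k"
    unfolding approximable_def by blast
  \<comment> \<open>Every member of the family takes algebraic values; the one with index 0 is
    picked.\<close>
  then show ?thesis
    using A finite_rat_ring_algebraic by (intro exI[of _ A] exI[of _ "\<phi> 0"]) blast
qed

section \<open>Rigid sets and coordinatewise specialization\<close>

theorem mainTheorem3:
  fixes x y :: "real ^ 'n"
  assumes "CARD('n) > 1"
    and "\<exists>S. finite S \<and> x \<in> S \<and> y \<in> S \<and>
           (\<forall>f :: real ^ 'n \<Rightarrow> real ^ 'n.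
              preserves_unit_distances S f \<longrightarrow> norm (f x - f y) = norm (x - y))"
  shows "algebraic (norm (x - y))"
proof -
  obtain S where S: "finite S" "x \<in> S" "y \<in> S"
    and rigid: "\<And>f :: real ^ 'n \<Rightarrow> real ^ 'n.
      preserves_unit_distances S f \<Longrightarrow> norm (f x - f y) = norm (x - y)"
    using assms(2) by blast
  obtain A \<phi> where A: "subring A" "(\<Union>i. (\<lambda>v. v $ i) ` S) \<subseteq> A" and hom: "ring_hom_on A \<phi>"
    and alg: "\<And>a. a \<in> A \<Longrightarrow> algebraic (\<phi> a :: real)"
    using ex_algebraic_specialization[of "\<Union>i. (\<lambda>v. v $ i) ` S"] S(1) by auto
  define f :: "real ^ 'n \<Rightarrow> real ^ 'n" where "f v = (\<chi> i. \<phi> (v $ i))" for v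
  \<comment> \<open>Squares are used because the distance itself need not lie in \<open>A\<close>,
    where alone \<open>\<phi>\<close> is known to be a homomorphism.\<close>
  have norm_sq: "(norm w)\<^sup>2 = (\<Sum>i\<in>UNIV. w $ i * w $ i)" for w :: "real ^ 'n"
    by (simp add: power2_norm_eq_inner inner_vec_def)
  have norm_A: "(norm (u - v))\<^sup>2 \<in> A" and norm_f: "(norm (f u - f v))\<^sup>2 = \<phi> ((norm (u - v))\<^sup>2)"
    if "u \<in> S" "v \<in> S" for u v
  proof -
    have uv: "u $ i \<in> A" "v $ i \<in> A" for i using that A(2) by auto
    have diff: "u $ i - v $ i \<in> A" for i by (intro subring_diff A(1) uv)
    have mult: "(u $ i - v $ i) * (u $ i - v $ i) \<in> A" for i by (intro subring_mult A(1) diff)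
    show "(norm (u - v))\<^sup>2 \<in> A"
      unfolding norm_sq by (auto intro!: subring_sum A(1) mult)
    show "(norm (f u - f v))\<^sup>2 = \<phi> ((norm (u - v))\<^sup>2)"
      unfolding norm_sq
      by (simp add: f_def hom_sum[OF A(1) hom mult] hom_mult[OF A(1) hom diff diff]
          hom_diff[OF A(1) hom uv])
  qed
  have "preserves_unit_distances S f"
    unfolding preserves_unit_distances_def
  proof (intro ballI impI)
    fix u v assume uv: "u \<in> S" "v \<in> S" "norm (u - v) = 1"
    then have "(norm (f u - f v))\<^sup>2 = 1"
      using norm_f[OF uv(1,2)] hom_1[OF A(1) hom] by simp
    then show "norm (f u - f v) = 1" by (simp add: abs_square_eq_1)
  qed
  \<comment> \<open>Rigidity turns the squared distance into a fixed point of \<open>\<phi>\<close>,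
    hence into one of its algebraic values.\<close>
  then have "(norm (x - y))\<^sup>2 = \<phi> ((norm (x - y))\<^sup>2)"
    using norm_f[OF S(2,3)] rigid by simp
  then have "algebraic ((norm (x - y))\<^sup>2)"
    using alg[OF norm_A[OF S(2,3)]] by simp
  then have "algebraic (sqrt ((norm (x - y))\<^sup>2))" by (rule algebraic_sqrt)
  then show ?thesis by simp
qed

end
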